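(* Let $b>0$ be fixed. For $J\ge1$ put $N=2^J-1$, $h=b/(N+1)=b/2^J$, $\delta=Rh$ with $R=3$ (and $\delta<b$), let $A_J=A_\delta^h$ be the $N\times N$ nonlocal stiffness matrix, and define the coarser-level matrices recursively by $A_{k-1}=I_k^{k-1}A_kI_{k-1}^k$. Let $0<\omega<1$, $0<\eta\le2\omega(1-\omega)$, and let $K_k=I-\omega D_k^{-1}A_k$ and $T^k$ be the damped Jacobi iteration matrix and the coarse-grid correction operator on level $k$. Then for all sufficiently small $h$ (i.e. in the regime $h\to0$), $$\|K_kT^k\|_{A_k}\le\sqrt{1-\eta/6}<1\qquad\text{for all }1\le k\le J.$$
   Context: **Stiffness matrix.** For $b>0$, $N\ge1$, $h=b/(N+1)$, $0<\delta<b$, set $R=\delta/h>0$ and $r=\lfloor R\rfloor$. For $R>1$ the matrix $A_\delta^h\in\mathbb{R}^{N\times N}$ is the symmetric Toeplitz matrix with entries $a_{i,j}=a_{|i-j|}$, where $a_k=0$ for $k>r+1$ and $a_p=-\dfrac{3}{h^2R^3}$ for $1\le p\le r-1$; $a_r=-\dfrac{3r-1+(R-r)(r^2+rR-2R^2+3r+3R)}{2h^2R^3r}$; $a_{r+1}=-\dfrac{(R-r)(2R^2-rR-r^2)}{2h^2R^3(r+1)}$; $a_0=-2\sum_{p=1}^{r+1}a_p$. **Multigrid operators.** Level $k$ has $N_k=2^k-1$ unknowns. The restriction $I_k^{k-1}:\mathbb{R}^{N_k}\to\mathbb{R}^{N_{k-1}}$ is $(I_k^{k-1}\nu)_i=\frac14(\nu_{2i-1}+2\nu_{2i}+\nu_{2i+1})$,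 $i=1,\dots,N_{k-1}$, and the prolongation is $I_{k-1}^k=2(I_k^{k-1})^T$. $D_k$ is the diagonal part of $A_k$. The coarse-grid correction operator on level $k$ is $T^k=I-I_{k-1}^kA_{k-1}^{-1}I_k^{k-1}A_k$; for $k=1$ the coarse space $\mathbb{R}^{N_0}$ is $\{0\}$, so $T^1=I$. **Norms.** For a symmetric positive definite matrix $M$, $\|\nu\|_M=(M\nu,\nu)^{1/2}$ with the Euclidean inner product, and for a matrix $B$, $\|B\|_M=\sup_{\nu\ne0}\|B\nu\|_M/\|\nu\|_M$. *)

theory Defs
  imports Complex_Main "Jordan_Normal_Form.Gauss_Jordan_Elimination"
begin

text \<open>
  The dimensions \<open>2^k - 1\<close> vary with the level \<open>k\<close>, so matrices and vectors are those of
  Jordan_Normal_Form, which carry their dimensions. They are indexed from \<open>0\<close>: the entry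
  \<open>a_{i,j}\<close> of the usual 1-based convention is \<open>A $$ (i - 1, j - 1)\<close>.
\<close>

text \<open>The coefficients are meant for \<open>R > 1\<close>; the value at \<open>p = 0\<close> is never used.\<close>

definition stiffness_offdiag :: "real \<Rightarrow> real \<Rightarrow> nat \<Rightarrow> real" where
  "stiffness_offdiag h R p =
    (let m = nat \<lfloor>R\<rfloor>; r = real m in
      if 1 \<le> p \<and> p < m then - 3 / (h^2 * R^3)
      else if p = m then
        - (3*r - 1 + (R - r) * (r^2 + r*R - 2*R^2 + 3*r + 3*R)) / (2 * h^2 * R^3 * r)
      else if p = m + 1 then
        - ((R - r) * (2*R^2 - r*R - r^2)) / (2 * h^2 * R^3 * (r + 1))
      else 0)"

definition stiffness_coeff :: "real \<Rightarrow> real \<Rightarrow> nat \<Rightarrow> real" where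
  "stiffness_coeff h R p =
    (if p = 0 then - 2 * (\<Sum>q = 1..nat \<lfloor>R\<rfloor> + 1. stiffness_offdiag h R q)
     else stiffness_offdiag h R p)"

definition stiffness_matrix :: "real \<Rightarrow> real \<Rightarrow> nat \<Rightarrow> real mat" where
  "stiffness_matrix \<delta> h N =
    mat N N (\<lambda>(i, j). stiffness_coeff h (\<delta> / h) (nat \<bar>int i - int j\<bar>))"

text \<open>\<open>restriction k\<close> maps level \<open>k\<close> to level \<open>k - 1\<close>, and \<open>prolongation k\<close> maps level \<open>k - 1\<close>
  to level \<open>k\<close>. In 0-based indices, \<open>2i - 1\<close>, \<open>2i\<close>, \<open>2i + 1\<close> become \<open>2i\<close>, \<open>2i + 1\<close>, \<open>2i + 2\<close>.\<close>

definition restriction :: "nat \<Rightarrow> real mat" where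
  "restriction k = mat (2^(k - 1) - 1) (2^k - 1) (\<lambda>(i, j).
     if j = 2*i \<or> j = 2*i + 2 then 1/4 else if j = 2*i + 1 then 1/2 else 0)"

definition prolongation :: "nat \<Rightarrow> real mat" where
  "prolongation k = 2 \<cdot>\<^sub>m transpose_mat (restriction k)"

text \<open>\<open>galerkin J A m\<close> is the matrix on level \<open>J - m\<close> obtained from the matrix \<open>A\<close> on
  level \<open>J\<close> by \<open>m\<close> Galerkin coarsenings.\<close>

primrec galerkin :: "nat \<Rightarrow> real mat \<Rightarrow> nat \<Rightarrow> real mat" where
  "galerkin J A 0 = A"
| "galerkin J A (Suc m) = restriction (J - m) * galerkin J A m * prolongation (J - m)"

definition level_matrix :: "nat \<Rightarrow> real mat \<Rightarrow> nat \<Rightarrow> real mat" where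
  "level_matrix J A k = galerkin J A (J - k)"

text \<open>\<open>the (mat_inverse A)\<close> is the inverse of an invertible square matrix, and unspecified otherwise.\<close>

definition diagonal_part :: "real mat \<Rightarrow> real mat" where
  "diagonal_part A = mat_diag (dim_row A) (\<lambda>i. A $$ (i, i))"

definition damped_jacobi :: "real \<Rightarrow> real mat \<Rightarrow> real mat" where
  "damped_jacobi \<omega> A = 1\<^sub>m (dim_row A) - \<omega> \<cdot>\<^sub>m (the (mat_inverse (diagonal_part A)) * A)"

definition coarse_correction :: "(nat \<Rightarrow> real mat) \<Rightarrow> nat \<Rightarrow> real mat" where
  "coarse_correction A k =
    (if k = 1 then 1\<^sub>m (dim_row (A k))
     else 1\<^sub>m (dim_row (A k))
       - prolongation k * the (mat_inverse (A (k - 1))) * restriction k * A k)"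

text \<open>The following two are meant for symmetric positive definite \<open>M\<close>, of positive dimension in
  the second case; the supremum is then that of a nonempty bounded set of reals.\<close>

definition energy_norm :: "real mat \<Rightarrow> real vec \<Rightarrow> real" where
  "energy_norm M v = sqrt ((M *\<^sub>v v) \<bullet> v)"

definition energy_opnorm :: "real mat \<Rightarrow> real mat \<Rightarrow> real" where
  "energy_opnorm M B =
    (SUP v \<in> {v \<in> carrier_vec (dim_row M). v \<noteq> 0\<^sub>v (dim_row M)}.
       energy_norm M (B *\<^sub>v v) / energy_norm M v)"

end

theory Submission
  imports Defs "Jordan_Normal_Form.Determinant"
begin

text \<open>
  The damped Jacobi sweep reduces the squared energy norm of \<open>u\<close> by at least \<open>\<eta> |A u|\<^sup>2 / d\<close>,
  where \<open>d\<close> is the constant diagonal entry of \<open>A\<close>, since \<open>A \<le> 2 d I\<close>. The coarse-grid correction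
  is the \<open>A\<close>-orthogonal projection along the range of the prolongation \<open>P\<close>, so an interpolation
  estimate \<open>d |v - P w|\<^sup>2 \<le> 6 |v|\<^sub>A\<^sup>2\<close> yields \<open>|u|\<^sub>A\<^sup>2 \<le> 6 |A u|\<^sup>2 / d\<close> for every \<open>u\<close> in the range
  of the correction.

  For \<open>R = 3\<close> the matrices on all levels are Toeplitz with first row
  \<open>2 (p + q + s), - p, - q, - s, 0, \<dots>\<close>, and coarsening maps \<open>(p, q, s)\<close> to
  \<open>((2 p + 4 q + 2 s) / 8, (q + 4 s) / 8, 0)\<close>. It preserves \<open>p > 0\<close>, \<open>q \<ge> 0\<close>, \<open>s \<ge> 0\<close> and
  \<open>q + s \<le> 2 p\<close>, from which both estimates follow on every level.
\<close>

lemma jacobi_energy: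
  fixes A :: "real mat"
  assumes A: "A \<in> carrier_mat n n" and sym: "A\<^sup>T = A" and u: "u \<in> carrier_vec n"
    and d: "d > 0" and upper: "\<And>v. v \<in> carrier_vec n \<Longrightarrow> (A *\<^sub>v v) \<bullet> v \<le> 2 * d * (v \<bullet> v)"
  defines "y \<equiv> A *\<^sub>v u"
  shows "(A *\<^sub>v (u - (\<omega> / d) \<cdot>\<^sub>v y)) \<bullet> (u - (\<omega> / d) \<cdot>\<^sub>v y)
    \<le> y \<bullet> u - 2 * \<omega> * (1 - \<omega>) / d * (y \<bullet> y)"
proof -
  define t where "t = \<omega> / d"
  have y: "y \<in> carrier_vec n" unfolding y_def using A u by simp
  have z: "A *\<^sub>v y \<in> carrier_vec n" using A y by simp
  have zu: "(A *\<^sub>v y) \<bullet> u = y \<bullet> y"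
    using transpose_vec_mult_scalar[OF A u y] sym by (simp add: y_def)
  have "A *\<^sub>v (u - t \<cdot>\<^sub>v y) = y - t \<cdot>\<^sub>v (A *\<^sub>v y)"
    unfolding y_def[symmetric]
    using mult_minus_distrib_mat_vec[OF A u, of "t \<cdot>\<^sub>v y"] mult_mat_vec[OF A y, of t] y
    by (simp add: y_def)
  then have "(A *\<^sub>v (u - t \<cdot>\<^sub>v y)) \<bullet> (u - t \<cdot>\<^sub>v y)
      = (y - t \<cdot>\<^sub>v (A *\<^sub>v y)) \<bullet> (u - t \<cdot>\<^sub>v y)" by simp
  also have "\<dots> = y \<bullet> u - 2 * t * (y \<bullet> y) + t\<^sup>2 * ((A *\<^sub>v y) \<bullet> y)"
    using u y z zu
    by (simp add: minus_scalar_prod_distrib[of _ n] scalar_prod_minus_distrib[of _ n]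
        algebra_simps power2_eq_square)
  also have "\<dots> \<le> y \<bullet> u - 2 * t * (y \<bullet> y) + t\<^sup>2 * (2 * d * (y \<bullet> y))"
    using mult_left_mono[OF upper[OF y], of "t\<^sup>2"] by simp
  also have "\<dots> = y \<bullet> u - 2 * \<omega> * (1 - \<omega>) / d * (y \<bullet> y)"
    using d by (simp add: t_def field_simps power2_eq_square)
  finally show ?thesis by (simp add: t_def)
qed

lemma two_grid_contraction:
  fixes A P T :: "real mat"
  assumes A: "A \<in> carrier_mat n n" and sym: "A\<^sup>T = A"
    and P: "P \<in> carrier_mat n m" and T: "T \<in> carrier_mat n n"
    and d: "d > 0" and \<eta>: "0 \<le> \<eta>" "\<eta> \<le> 2 * \<omega> * (1 - \<omega>)"
    and pos: "\<And>v. v \<in> carrier_vec n \<Longrightarrow> (A *\<^sub>v v) \<bullet> v \<ge> 0"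
    and upper: "\<And>v. v \<in> carrier_vec n \<Longrightarrow> (A *\<^sub>v v) \<bullet> v \<le> 2 * d * (v \<bullet> v)"
    and orth: "\<And>v z. v \<in> carrier_vec n \<Longrightarrow> z \<in> carrier_vec m \<Longrightarrow>
      (A *\<^sub>v (T *\<^sub>v v)) \<bullet> (P *\<^sub>v z) = 0"
    and range: "\<And>v. v \<in> carrier_vec n \<Longrightarrow> \<exists>z \<in> carrier_vec m. v = T *\<^sub>v v + P *\<^sub>v z"
    and approx: "\<And>v. v \<in> carrier_vec n \<Longrightarrow> \<exists>z \<in> carrier_vec m.
      d * ((v - P *\<^sub>v z) \<bullet> (v - P *\<^sub>v z)) \<le> 6 * ((A *\<^sub>v v) \<bullet> v)"
    and v: "v \<in> carrier_vec n"
  defines "u \<equiv> T *\<^sub>v v"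
  shows "(A *\<^sub>v (u - (\<omega> / d) \<cdot>\<^sub>v (A *\<^sub>v u))) \<bullet> (u - (\<omega> / d) \<cdot>\<^sub>v (A *\<^sub>v u))
    \<le> (1 - \<eta> / 6) * ((A *\<^sub>v v) \<bullet> v)"
proof -
  define y where "y = A *\<^sub>v u"
  have u: "u \<in> carrier_vec n" unfolding u_def using T v by simp
  have y: "y \<in> carrier_vec n" unfolding y_def using A u by simp
  have yy: "y \<bullet> y \<ge> 0" by (simp add: scalar_prod_def sum_nonneg)
  obtain w where w: "w \<in> carrier_vec m"
    and wle: "d * ((u - P *\<^sub>v w) \<bullet> (u - P *\<^sub>v w)) \<le> 6 * (y \<bullet> u)"
    using approx[OF u] unfolding y_def by blast
  define e where "e = u - P *\<^sub>v w"
  have Pw: "P *\<^sub>v w \<in> carrier_vec n" using P w by simp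
  have e: "e \<in> carrier_vec n" unfolding e_def using u Pw by simp
  have ye: "y \<bullet> e = y \<bullet> u"
    using orth[OF v w] scalar_prod_minus_distrib[OF y u Pw] by (simp add: e_def y_def u_def)
  have "0 \<le> (6 \<cdot>\<^sub>v y - d \<cdot>\<^sub>v e) \<bullet> (6 \<cdot>\<^sub>v y - d \<cdot>\<^sub>v e)"
    by (simp add: scalar_prod_def sum_nonneg)
  also have "\<dots> = 36 * (y \<bullet> y) - 12 * d * (y \<bullet> e) + d * (d * (e \<bullet> e))"
    using y e by (simp add: minus_scalar_prod_distrib[of _ n] scalar_prod_minus_distrib[of _ n]
        comm_scalar_prod[OF e y] algebra_simps)
  also have "\<dots> \<le> 36 * (y \<bullet> y) - 12 * d * (y \<bullet> u) + d * (6 * (y \<bullet> u))"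
    using mult_left_mono[OF wle, of d] d by (simp add: ye flip: e_def)
  finally have "y \<bullet> u \<le> 6 / d * (y \<bullet> y)" using d by (simp add: field_simps)
  then have "\<eta> / 6 * (y \<bullet> u) \<le> \<eta> / 6 * (6 / d * (y \<bullet> y))"
    using \<eta>(1) by (intro mult_left_mono) auto
  also have "\<dots> \<le> 2 * \<omega> * (1 - \<omega>) / d * (y \<bullet> y)"
    using \<eta>(2) d yy by (auto intro!: mult_right_mono divide_right_mono)
  finally have gain: "\<eta> / 6 * (y \<bullet> u) \<le> 2 * \<omega> * (1 - \<omega>) / d * (y \<bullet> y)" .
  have smooth: "(A *\<^sub>v (u - (\<omega> / d) \<cdot>\<^sub>v y)) \<bullet> (u - (\<omega> / d) \<cdot>\<^sub>v y) \<le> (1 - \<eta> / 6) * (y \<bullet> u)"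
    using jacobi_energy[OF A sym u d upper, of \<omega>] gain
    unfolding y_def[symmetric] left_diff_distrib mult_1 by linarith
  obtain z where z: "z \<in> carrier_vec m" and vz: "v = u + P *\<^sub>v z"
    using range[OF v] by (auto simp: u_def)
  have Pz: "P *\<^sub>v z \<in> carrier_vec n" using P z by simp
  have APz: "A *\<^sub>v (P *\<^sub>v z) \<in> carrier_vec n" using A Pz by simp
  have "y \<bullet> (P *\<^sub>v z) = 0" using orth[OF v z] by (simp add: y_def u_def)
  moreover have "(A *\<^sub>v (P *\<^sub>v z)) \<bullet> u = y \<bullet> (P *\<^sub>v z)"
    using transpose_vec_mult_scalar[OF A u Pz] sym comm_scalar_prod[OF Pz y]
    by (simp add: y_def)
  moreover have "(A *\<^sub>v v) \<bullet> v = (y + A *\<^sub>v (P *\<^sub>v z)) \<bullet> (u + P *\<^sub>v z)"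
    unfolding vz y_def using mult_add_distrib_mat_vec[OF A u Pz] by simp
  ultimately have "(A *\<^sub>v v) \<bullet> v = y \<bullet> u + (A *\<^sub>v (P *\<^sub>v z)) \<bullet> (P *\<^sub>v z)"
    using u y Pz APz by (simp add: add_scalar_prod_distrib[of _ n] scalar_prod_add_distrib[of _ n])
  then have le: "y \<bullet> u \<le> (A *\<^sub>v v) \<bullet> v" using pos[OF Pz] by simp
  have "2 * \<omega> * (1 - \<omega>) \<le> 1"
    using sum_squares_ge_zero[of "2 * \<omega> - 1" 0] by (simp add: algebra_simps)
  then have "1 - \<eta> / 6 \<ge> 0" using \<eta> by simp
  then have "(1 - \<eta> / 6) * (y \<bullet> u) \<le> (1 - \<eta> / 6) * ((A *\<^sub>v v) \<bullet> v)"
    using le by (intro mult_left_mono)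
  with smooth show ?thesis by (simp add: y_def)
qed

lemma mat_inverse_eqI:
  fixes A B :: "'a :: field mat"
  assumes A: "A \<in> carrier_mat n n" and B: "B \<in> carrier_mat n n" and AB: "A * B = 1\<^sub>m n"
  shows "mat_inverse A = Some B"
proof -
  have BA: "B * A = 1\<^sub>m n" using mat_mult_left_right_inverse[OF A B AB] .
  have "A \<in> Units (ring_mat TYPE('a) n ())"
    using A B AB BA by (auto simp: Units_def ring_mat_def)
  then obtain C where C: "mat_inverse A = Some C"
    using mat_inverse(1)[OF A, of "()"] by (cases "mat_inverse A") auto
  note C' = mat_inverse(2)[OF A C]
  then have "C = B * A * C" unfolding BA by (metis left_mult_one_mat)
  also have "\<dots> = B" using C' A B by (simp add: assoc_mult_mat[of _ n n _ n _ n])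
  finally show ?thesis using C by simp
qed

lemma pos_def_mat_inverse:
  fixes A :: "real mat"
  assumes A: "A \<in> carrier_mat n n"
    and pos: "\<And>v. v \<in> carrier_vec n \<Longrightarrow> v \<noteq> 0\<^sub>v n \<Longrightarrow> (A *\<^sub>v v) \<bullet> v > 0"
  obtains B where "mat_inverse A = Some B" "B \<in> carrier_mat n n" "A * B = 1\<^sub>m n"
proof -
  have "det A \<noteq> 0"
    unfolding det_0_iff_vec_prod_zero_field[OF A] using pos by fastforce
  then have "A \<in> Units (ring_mat TYPE(real) n ())" by (rule det_non_zero_imp_unit[OF A])
  then obtain B where B: "mat_inverse A = Some B"
    using mat_inverse(1)[OF A, of "()"] by (cases "mat_inverse A") auto
  with mat_inverse(2)[OF A B] that show thesis by blast
qed

lemma damped_jacobi_eq: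
  assumes A: "A \<in> carrier_mat n n" and diag: "\<And>i. i < n \<Longrightarrow> A $$ (i, i) = d" and d: "d \<noteq> 0"
  shows "damped_jacobi \<omega> A = 1\<^sub>m n - (\<omega> / d) \<cdot>\<^sub>m A"
proof -
  have D: "diagonal_part A = mat_diag n (\<lambda>_. d)"
    using A diag by (auto simp: diagonal_part_def mat_diag_def)
  have inv: "mat_inverse (diagonal_part A) = Some (mat_diag n (\<lambda>_. 1 / d))"
    unfolding D by (rule mat_inverse_eqI[of _ n]) (use d in auto)
  have DA: "mat_diag n (\<lambda>_. 1 / d) * A = (1 / d) \<cdot>\<^sub>m A"
    using A by (subst mat_diag_mult_left[OF A]) auto
  show ?thesis using A by (auto simp: damped_jacobi_def inv DA)
qed

lemma damped_jacobi_apply: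
  assumes A: "A \<in> carrier_mat n n" and diag: "\<And>i. i < n \<Longrightarrow> A $$ (i, i) = d"
    and d: "d \<noteq> 0" and u: "u \<in> carrier_vec n"
  shows "damped_jacobi \<omega> A *\<^sub>v u = u - (\<omega> / d) \<cdot>\<^sub>v (A *\<^sub>v u)"
proof -
  have "damped_jacobi \<omega> A = 1\<^sub>m n - (\<omega> / d) \<cdot>\<^sub>m A"
    using A diag d by (rule damped_jacobi_eq)
  also have "\<dots> *\<^sub>v u = 1\<^sub>m n *\<^sub>v u - ((\<omega> / d) \<cdot>\<^sub>m A) *\<^sub>v u"
    using A u by (intro minus_mult_distrib_mat_vec) auto
  also have "((\<omega> / d) \<cdot>\<^sub>m A) *\<^sub>v u = (\<omega> / d) \<cdot>\<^sub>v (A *\<^sub>v u)"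
    using A u by (intro eq_vecI) auto
  finally show ?thesis using u by simp
qed

definition band_coeff :: "real \<Rightarrow> real \<Rightarrow> real \<Rightarrow> int \<Rightarrow> real" where
  "band_coeff p q s x =
    (if x = 0 then 2 * (p + q + s) else if \<bar>x\<bar> = 1 then - p
     else if \<bar>x\<bar> = 2 then - q else if \<bar>x\<bar> = 3 then - s else 0)"

definition toeplitz :: "nat \<Rightarrow> (int \<Rightarrow> real) \<Rightarrow> real mat" where
  "toeplitz n c = mat n n (\<lambda>(i, j). c (int i - int j))"

lemma toeplitz_carrier [simp]: "toeplitz n c \<in> carrier_mat n n"
  and dim_toeplitz [simp]: "dim_row (toeplitz n c) = n" "dim_col (toeplitz n c) = n"
  by (simp_all add: toeplitz_def)

lemma transpose_toeplitz_band: "(toeplitz n (band_coeff p q s))\<^sup>T = toeplitz n (band_coeff p q s)"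
  by (rule eq_matI) (auto simp: toeplitz_def band_coeff_def abs_minus_commute)

lemma stiffness_matrix_R3:
  assumes "h > 0"
  shows "stiffness_matrix (3 * h) h N =
    toeplitz N (band_coeff (1 / (9 * h\<^sup>2)) (1 / (9 * h\<^sup>2)) (4 / (81 * h\<^sup>2)))"
proof -
  have R: "3 * h / h = 3" using assms by simp
  have off: "stiffness_offdiag h 3 q =
      (if 1 \<le> q \<and> q < 3 then - 1 / (9 * h\<^sup>2) else if q = 3 then - 4 / (81 * h\<^sup>2) else 0)" for q
    using assms by (simp add: stiffness_offdiag_def Let_def field_simps)
  have set4: "{1..4::nat} = {1, 2, 3, 4}" by auto
  have c0: "stiffness_coeff h 3 0 = 2 * (1 / (9 * h\<^sup>2) + 1 / (9 * h\<^sup>2) + 4 / (81 * h\<^sup>2))"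
    by (simp add: stiffness_coeff_def off set4 del: One_nat_def)
  have "stiffness_coeff h 3 (nat \<bar>x\<bar>) = band_coeff (1 / (9 * h\<^sup>2)) (1 / (9 * h\<^sup>2)) (4 / (81 * h\<^sup>2)) x"
    for x :: int
  proof (cases "x = 0")
    case True
    then show ?thesis using c0 by (simp add: band_coeff_def)
  next
    case False
    then show ?thesis
      by (auto simp: stiffness_coeff_def off band_coeff_def nat_eq_iff nat_less_iff)
  qed
  then show ?thesis unfolding stiffness_matrix_def toeplitz_def R by simp
qed

lemma restriction_carrier [simp]: "restriction k \<in> carrier_mat (2^(k - 1) - 1) (2^k - 1)"
  by (simp add: restriction_def)

lemma prolongation_carrier [simp]: "prolongation k \<in> carrier_mat (2^k - 1) (2^(k - 1) - 1)"
  by (simp add: prolongation_def restriction_def)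

lemma prolongation_index:
  "l < 2^k - 1 \<Longrightarrow> i < 2^(k - 1) - 1 \<Longrightarrow> prolongation k $$ (l, i) =
    (if l = 2 * i \<or> l = 2 * i + 2 then 1 / 2 else if l = 2 * i + 1 then 1 else 0)"
  by (simp add: prolongation_def restriction_def)

lemma restriction_row_sum:
  assumes k: "k \<ge> 1" and i: "i < 2^(k - 1) - 1"
  shows "(\<Sum>l<2^k - 1. restriction k $$ (i, l) * f l)
    = (f (2 * i) + 2 * f (2 * i + 1) + f (2 * i + 2)) / 4"
proof -
  have n: "(2::nat)^k = 2 * 2^(k - 1)" using k by (cases k) auto
  have "(\<Sum>l<2^k - 1. restriction k $$ (i, l) * f l)
      = (\<Sum>l \<in> {2 * i, 2 * i + 1, 2 * i + 2}. restriction k $$ (i, l) * f l)"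
    using i n by (intro sum.mono_neutral_right) (auto simp: restriction_def)
  also have "\<dots> = (f (2 * i) + 2 * f (2 * i + 1) + f (2 * i + 2)) / 4"
    using i n by (simp add: restriction_def field_simps)
  finally show ?thesis .
qed

lemma galerkin_toeplitz:
  assumes k: "k \<ge> 1"
  shows "restriction k * toeplitz (2^k - 1) c * prolongation k = toeplitz (2^(k - 1) - 1)
    (\<lambda>x. (c (2 * x - 2) + 4 * c (2 * x - 1) + 6 * c (2 * x) + 4 * c (2 * x + 1) + c (2 * x + 2)) / 8)"
    (is "?L = ?R")
proof (rule eq_matI)
  define n m :: nat where "n = 2^k - 1" and "m = 2^(k - 1) - 1"
  fix i j assume "i < dim_row ?R" "j < dim_col ?R"
  then have i: "i < m" and j: "j < m" by (simp_all add: m_def)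
  have R: "restriction k \<in> carrier_mat m n" and P: "prolongation k \<in> carrier_mat n m"
    unfolding m_def n_def by (rule restriction_carrier prolongation_carrier)+
  have "?L $$ (i, j) = (\<Sum>l<n. (\<Sum>l'<n. restriction k $$ (i, l') * toeplitz n c $$ (l', l))
      * prolongation k $$ (l, j))"
    unfolding n_def[symmetric] lessThan_atLeast0
    using i j R P by (auto simp: scalar_prod_def intro!: sum.cong)
  also have "\<dots> = 2 * (\<Sum>l<n. restriction k $$ (j, l) *
      (\<Sum>l'<n. restriction k $$ (i, l') * c (int l' - int l)))"
    unfolding sum_distrib_left[of 2]
    using R j by (intro sum.cong) (auto simp: toeplitz_def prolongation_def)
  also have "\<dots> = ?R $$ (i, j)"
    using i j unfolding n_def restriction_row_sum[OF k i[unfolded m_def]]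
      restriction_row_sum[OF k j[unfolded m_def]]
    by (simp add: m_def toeplitz_def algebra_simps add_divide_distrib)
  finally show "?L $$ (i, j) = ?R $$ (i, j)" .
qed (simp_all add: restriction_def prolongation_def)

lemma galerkin_band:
  assumes "k \<ge> 1"
  shows "restriction k * toeplitz (2^k - 1) (band_coeff p q s) * prolongation k =
    toeplitz (2^(k - 1) - 1) (band_coeff ((2 * p + 4 * q + 2 * s) / 8) ((q + 4 * s) / 8) 0)"
proof -
  let ?c = "band_coeff p q s"
  have "(?c (2 * x - 2) + 4 * ?c (2 * x - 1) + 6 * ?c (2 * x) + 4 * ?c (2 * x + 1) + ?c (2 * x + 2)) / 8
      = band_coeff ((2 * p + 4 * q + 2 * s) / 8) ((q + 4 * s) / 8) 0 x" for x
  proof (cases "\<bar>x\<bar> \<le> 2")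
    case True
    then consider "x = 0" | "x = 1" | "x = - 1" | "x = 2" | "x = - 2" by linarith
    then show ?thesis by cases (simp_all add: band_coeff_def field_simps)
  next
    case False
    have zero: "band_coeff p q s y = 0" if "\<bar>y\<bar> > 3" for p q s y
      using that by (simp add: band_coeff_def)
    have far: "\<bar>2 * x - 2\<bar> > 3" "\<bar>2 * x - 1\<bar> > 3" "\<bar>2 * x\<bar> > 3" "\<bar>2 * x + 1\<bar> > 3"
      "\<bar>2 * x + 2\<bar> > 3" using False by linarith+
    have "band_coeff p' q' 0 x = 0" for p' q'
      using False by (simp add: band_coeff_def)
    then show ?thesis unfolding far[THEN zero] by simp
  qed
  then show ?thesis unfolding galerkin_toeplitz[OF assms] by (simp only:)
qed

lemma galerkin_level:
  assumes "p > 0" "q \<ge> 0" "s \<ge> 0" "q + s \<le> 2 * p" and "m < J"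
  shows "\<exists>p' q' s'. p' > 0 \<and> q' \<ge> 0 \<and> s' \<ge> 0 \<and> q' + s' \<le> 2 * p' \<and>
    galerkin J (toeplitz (2^J - 1) (band_coeff p q s)) m
      = toeplitz (2^(J - m) - 1) (band_coeff p' q' s')"
  using \<open>m < J\<close>
proof (induction m)
  case 0
  then show ?case using assms by auto
next
  case (Suc m)
  then obtain p' q' s' where pqs: "p' > 0" "q' \<ge> 0" "s' \<ge> 0" "q' + s' \<le> 2 * p'"
    and eq: "galerkin J (toeplitz (2^J - 1) (band_coeff p q s)) m
      = toeplitz (2^(J - m) - 1) (band_coeff p' q' s')" by auto
  show ?case
    apply (rule exI[of _ "(2 * p' + 4 * q' + 2 * s') / 8"])
    apply (rule exI[of _ "(q' + 4 * s') / 8"])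
    apply (rule exI[of _ 0])
    using pqs Suc.prems by (simp add: eq galerkin_band field_simps del: One_nat_def) simp
qed

definition zext :: "nat \<Rightarrow> real vec \<Rightarrow> nat \<Rightarrow> real" where
  "zext n v i = (if i < n then v $ i else 0)"

definition autocorr :: "nat \<Rightarrow> real vec \<Rightarrow> nat \<Rightarrow> real" where
  "autocorr n v t = (\<Sum>i<n. zext n v i * zext n v (i + t))"

lemma autocorr_0: "v \<in> carrier_vec n \<Longrightarrow> autocorr n v 0 = v \<bullet> v"
  by (auto simp: autocorr_def zext_def scalar_prod_def lessThan_atLeast0 intro!: sum.cong)

lemma sum_shift_le:
  fixes f :: "nat \<Rightarrow> real"
  assumes "\<And>i. f i \<ge> 0" "\<And>i. i \<ge> n \<Longrightarrow> f i = 0"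
  shows "(\<Sum>i<n. f (i + t)) \<le> (\<Sum>i<n. f i)"
proof -
  have "(\<Sum>i<n. f (i + t)) = sum f {t..<n + t}"
    by (simp add: sum.shift_bounds_nat_ivl[of f 0 t n, simplified] lessThan_atLeast0)
  also have "\<dots> = sum f ({t..<n + t} \<inter> {..<n})"
    by (intro sum.mono_neutral_right) (auto intro: assms(2) simp: not_less[symmetric])
  also have "\<dots> \<le> sum f {..<n}" using assms(1) by (intro sum_mono2) auto
  finally show ?thesis .
qed

lemma abs_autocorr_le: "\<bar>autocorr n v t\<bar> \<le> autocorr n v 0"
proof -
  let ?x = "zext n v"
  have "\<bar>autocorr n v t\<bar> \<le> (\<Sum>i<n. \<bar>?x i * ?x (i + t)\<bar>)"
    unfolding autocorr_def by (rule sum_abs)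
  also have "\<dots> \<le> (\<Sum>i<n. ((?x i)\<^sup>2 + (?x (i + t))\<^sup>2) / 2)"
  proof (rule sum_mono)
    fix i
    show "\<bar>?x i * ?x (i + t)\<bar> \<le> ((?x i)\<^sup>2 + (?x (i + t))\<^sup>2) / 2"
      using sum_squares_bound[of "\<bar>?x i\<bar>" "\<bar>?x (i + t)\<bar>"] by (simp add: abs_mult)
  qed
  also have "\<dots> = ((\<Sum>i<n. (?x i)\<^sup>2) + (\<Sum>i<n. (?x (i + t))\<^sup>2)) / 2"
    by (simp add: sum_divide_distrib[symmetric] sum.distrib)
  also have "\<dots> \<le> (\<Sum>i<n. (?x i)\<^sup>2)"
    using sum_shift_le[of "\<lambda>i. (?x i)\<^sup>2" n t] by (simp add: zext_def)
  also have "\<dots> = autocorr n v 0" by (simp add: autocorr_def power2_eq_square)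
  finally show ?thesis .
qed

lemma toeplitz_band_form:
  assumes v: "v \<in> carrier_vec n"
  shows "(toeplitz n (band_coeff p q s) *\<^sub>v v) \<bullet> v =
    2 * (p + q + s) * autocorr n v 0
    - 2 * (p * autocorr n v 1 + q * autocorr n v 2 + s * autocorr n v 3)"
proof -
  let ?x = "zext n v"
  have pick: "(\<Sum>j<n. of_bool (j = i + t) * ?x j) = ?x (i + t)" for i t
    by (simp add: zext_def of_bool_def if_distrib[of "\<lambda>z. z * _"] sum.delta cong: if_cong)
  have up: "(\<Sum>i<n. \<Sum>j<n. of_bool (j = i + t) * ?x j * ?x i) = autocorr n v t" for t
    unfolding autocorr_def sum_distrib_right[symmetric] pick by (simp add: mult.commute)
  have down: "(\<Sum>i<n. \<Sum>j<n. of_bool (i = j + t) * ?x j * ?x i) = autocorr n v t" for t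
    by (subst sum.swap) (use up[of t] in \<open>simp add: mult_ac\<close>)
  have c: "band_coeff p q s (int i - int j) = 2 * (p + q + s) * of_bool (j = i + 0)
      - p * (of_bool (j = i + 1) + of_bool (i = j + 1))
      - q * (of_bool (j = i + 2) + of_bool (i = j + 2))
      - s * (of_bool (j = i + 3) + of_bool (i = j + 3))" for i j
    unfolding band_coeff_def by (auto simp: abs_if)
  have "(toeplitz n (band_coeff p q s) *\<^sub>v v) \<bullet> v
      = (\<Sum>i<n. \<Sum>j<n. band_coeff p q s (int i - int j) * ?x j * ?x i)"
    using v by (auto simp: scalar_prod_def lessThan_atLeast0 toeplitz_def zext_def
        sum_distrib_right intro!: sum.cong)
  also have "\<dots> = (\<Sum>i<n. \<Sum>j<n. 2 * (p + q + s) * (of_bool (j = i + 0) * ?x j * ?x i)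
      - p * (of_bool (j = i + 1) * ?x j * ?x i + of_bool (i = j + 1) * ?x j * ?x i)
      - q * (of_bool (j = i + 2) * ?x j * ?x i + of_bool (i = j + 2) * ?x j * ?x i)
      - s * (of_bool (j = i + 3) * ?x j * ?x i + of_bool (i = j + 3) * ?x j * ?x i))"
    unfolding c by (simp only: algebra_simps)
  also have "\<dots> = 2 * (p + q + s) * autocorr n v 0 - p * (autocorr n v 1 + autocorr n v 1)
      - q * (autocorr n v 2 + autocorr n v 2) - s * (autocorr n v 3 + autocorr n v 3)"
    unfolding sum_subtractf sum.distrib sum_distrib_left[symmetric] up down ..
  finally show ?thesis by (simp add: algebra_simps)
qed

lemma toeplitz_band_upper:
  assumes "v \<in> carrier_vec n" "p \<ge> 0" "q \<ge> 0" "s \<ge> 0"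
  shows "(toeplitz n (band_coeff p q s) *\<^sub>v v) \<bullet> v \<le> 2 * (2 * (p + q + s)) * (v \<bullet> v)"
proof -
  have "- autocorr n v t \<le> autocorr n v 0" for t using abs_autocorr_le[of n v t] by linarith
  then have "a \<ge> 0 \<Longrightarrow> - (a * autocorr n v t) \<le> a * autocorr n v 0" for a t
    by (metis mult_left_mono mult_minus_right)
  from this[OF assms(2), of 1] this[OF assms(3), of 2] this[OF assms(4), of 3]
  show ?thesis
    unfolding toeplitz_band_form[OF assms(1)] autocorr_0[OF assms(1)] by (simp add: algebra_simps)
qed

lemma toeplitz_band_lower:
  assumes "v \<in> carrier_vec n" "q \<ge> 0" "s \<ge> 0"
  shows "2 * p * (autocorr n v 0 - autocorr n v 1) \<le> (toeplitz n (band_coeff p q s) *\<^sub>v v) \<bullet> v"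
proof -
  have "autocorr n v t \<le> autocorr n v 0" for t using abs_autocorr_le[of n v t] by linarith
  then have "a \<ge> 0 \<Longrightarrow> a * autocorr n v t \<le> a * autocorr n v 0" for a t
    by (rule mult_left_mono)
  from this[OF assms(2), of 2] this[OF assms(3), of 3]
  show ?thesis
    unfolding toeplitz_band_form[OF assms(1)] by (simp add: algebra_simps)
qed

lemma sum_diff_squares:
  "2 * (autocorr n v 0 - autocorr n v 1)
    = (zext n v 0)\<^sup>2 + (\<Sum>i<n. (zext n v (Suc i) - zext n v i)\<^sup>2)"
proof -
  let ?x = "zext n v"
  have "(\<Sum>i<n. (?x (Suc i))\<^sup>2) + (?x 0)\<^sup>2 = (\<Sum>i<Suc n. (?x i)\<^sup>2)"
    by (subst sum.lessThan_Suc_shift) simp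
  also have "\<dots> = (\<Sum>i<n. (?x i)\<^sup>2)" by (simp add: zext_def)
  finally have "(\<Sum>i<n. (?x (Suc i))\<^sup>2) = (\<Sum>i<n. (?x i)\<^sup>2) - (?x 0)\<^sup>2" by simp
  moreover have "(\<Sum>i<n. (?x (Suc i) - ?x i)\<^sup>2)
      = (\<Sum>i<n. (?x (Suc i))\<^sup>2) + (\<Sum>i<n. (?x i)\<^sup>2) - 2 * autocorr n v 1"
    by (simp add: autocorr_def power2_diff sum.distrib sum_subtractf sum_distrib_left mult_ac)
  ultimately show ?thesis by (simp add: autocorr_def power2_eq_square)
qed

lemma autocorr_diff_pos:
  assumes v: "v \<in> carrier_vec n" and nz: "v \<noteq> 0\<^sub>v n"
  shows "autocorr n v 0 - autocorr n v 1 > 0"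
proof (rule ccontr)
  assume "\<not> ?thesis"
  with sum_diff_squares[of n v] have
    le: "(zext n v 0)\<^sup>2 + (\<Sum>i<n. (zext n v (Suc i) - zext n v i)\<^sup>2) \<le> 0" by simp
  have nn: "0 \<le> (\<Sum>i<n. (zext n v (Suc i) - zext n v i)\<^sup>2)" by (simp add: sum_nonneg)
  have "(zext n v 0)\<^sup>2 \<le> 0" using le nn by linarith
  then have x0: "zext n v 0 = 0" by simp
  have "(\<Sum>i<n. (zext n v (Suc i) - zext n v i)\<^sup>2) = 0" using le nn x0 by simp
  then have step: "zext n v (Suc i) = zext n v i" if "i < n" for i
    using that by (simp add: sum_nonneg_eq_0_iff)
  have "zext n v i = 0" if "i < n" for i
    using that by (induction i) (simp_all add: x0 step)
  then have "v = 0\<^sub>v n" using v by (intro eq_vecI) (auto simp: zext_def)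
  with nz show False by simp
qed

lemma toeplitz_band_pos:
  assumes "v \<in> carrier_vec n" "v \<noteq> 0\<^sub>v n" "p > 0" "q \<ge> 0" "s \<ge> 0"
  shows "(toeplitz n (band_coeff p q s) *\<^sub>v v) \<bullet> v > 0"
  using toeplitz_band_lower[OF assms(1,4,5), of p]
    mult_pos_pos[OF assms(3) autocorr_diff_pos[OF assms(1,2)]] by linarith

text \<open>The witness interpolates \<open>v\<close> at the coarse grid points, which have odd 0-based indices.\<close>

lemma interpolation_estimate:
  assumes k: "k \<ge> 1" and v: "v \<in> carrier_vec n" and n: "n = 2^k - 1"
  defines "w \<equiv> vec (2^(k - 1) - 1) (\<lambda>i. v $ (2 * i + 1))"
  shows "(v - prolongation k *\<^sub>v w) \<bullet> (v - prolongation k *\<^sub>v w)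
    \<le> 2 * (autocorr n v 0 - autocorr n v 1)"
proof -
  define m :: nat where "m = 2^(k - 1) - 1"
  have "(2::nat)^k = 2 * 2^(k - 1)" using k by (cases k) auto
  then have nm: "n = 2 * m + 1"
    using one_le_power[of "2::nat" "k - 1"] unfolding n m_def by linarith
  let ?x = "zext n v"
  define y where "y = case_nat 0 ?x"
  have ysuc: "y (Suc i) = ?x i" for i by (simp add: y_def)
  define e where "e = v - prolongation k *\<^sub>v w"
  have P: "prolongation k \<in> carrier_mat n m"
    unfolding n m_def by (rule prolongation_carrier)
  have Pw: "(prolongation k *\<^sub>v w) $ l = (if odd l then ?x l else (?x (Suc l) + y l) / 2)"
    if l: "l < n" for l
  proof -
    have "(prolongation k *\<^sub>v w) $ l = (\<Sum>i<m. prolongation k $$ (l, i) * v $ (2 * i + 1))"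
      unfolding w_def m_def[symmetric] lessThan_atLeast0
      using P l by (auto simp: scalar_prod_def intro!: sum.cong)
    also have "\<dots> = (\<Sum>i<m. (if l = 2 * i \<or> l = 2 * i + 2 then 1 / 2
        else if l = 2 * i + 1 then 1 else 0) * ?x (2 * i + 1))"
    proof (rule sum.cong)
      fix i assume "i \<in> {..<m}"
      then have i: "i < 2^(k - 1) - 1" "2 * i + 1 < n" using nm by (auto simp: m_def)
      then show "prolongation k $$ (l, i) * v $ (2 * i + 1) =
          (if l = 2 * i \<or> l = 2 * i + 2 then 1 / 2 else if l = 2 * i + 1 then 1 else 0)
            * ?x (2 * i + 1)"
        using prolongation_index[of l k i] l by (simp add: n zext_def)
    qed simp
    also have "\<dots> = (if odd l then ?x l else (?x (Suc l) + y l) / 2)"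
    proof (cases "odd l")
      case True
      then obtain a where a: "l = 2 * a + 1" by (elim oddE)
      then have "a < m" using l nm by simp
      have "(\<Sum>i<m. (if l = 2 * i \<or> l = 2 * i + 2 then 1 / 2
          else if l = 2 * i + 1 then 1 else 0) * ?x (2 * i + 1)) = (\<Sum>i<m. if i = a then ?x l else 0)"
      proof (rule sum.cong[OF refl])
        fix i
        have "l \<noteq> 2 * i" "l \<noteq> 2 * i + 2" using True by auto
        then show "(if l = 2 * i \<or> l = 2 * i + 2 then 1 / 2
          else if l = 2 * i + 1 then 1 else 0) * ?x (2 * i + 1) = (if i = a then ?x l else 0)"
          by (simp add: a)
      qed
      then show ?thesis using \<open>a < m\<close> True by simp
    next
      case False
      then obtain a where a: "l = 2 * a" by (auto elim: evenE)
      then have am: "a \<le> m" using l nm by simp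
      have "(\<Sum>i<m. (if l = 2 * i \<or> l = 2 * i + 2 then 1 / 2
          else if l = 2 * i + 1 then 1 else 0) * ?x (2 * i + 1))
        = (\<Sum>i<m. (if i = a then ?x (Suc l) / 2 else 0) + (if Suc i = a then y l / 2 else 0))"
        using a by (intro sum.cong) (auto simp: y_def)
      also have "\<dots> = (?x (Suc l) + y l) / 2"
      proof (cases a)
        case 0
        then show ?thesis using a nm by (simp add: sum.distrib y_def zext_def)
      next
        case (Suc a')
        then show ?thesis using a am nm by (simp add: sum.distrib zext_def)
      qed
      finally show ?thesis using False by simp
    qed
    finally show ?thesis .
  qed
  have el: "(e $ l)\<^sup>2 \<le> ((y (Suc l) - y l)\<^sup>2 + (y (Suc (Suc l)) - y (Suc l))\<^sup>2) / 2"
    if l: "l < n" for l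
  proof -
    have "e $ l = v $ l - (prolongation k *\<^sub>v w) $ l"
      using l P v by (simp add: e_def del: index_mult_mat_vec)
    then have el: "e $ l = (if odd l then 0 else ((y (Suc l) - y l) - (y (Suc (Suc l)) - y (Suc l))) / 2)"
      using Pw[OF l] l
      by (cases "odd l") (simp_all add: ysuc zext_def[of n v l] diff_divide_distrib add_divide_distrib)
    have half: "((a - c) / 2)\<^sup>2 \<le> (a\<^sup>2 + c\<^sup>2) / 2" for a c :: real
      using zero_le_power2[of "a + c"] by (simp add: power_divide power2_sum power2_diff)
    show ?thesis
      using el half[of "y (Suc l) - y l" "y (Suc (Suc l)) - y (Suc l)"]
      by (cases "odd l") (simp_all only: if_True if_False, simp)
  qed
  have edim: "dim_vec e = n" using P v by (simp add: e_def)
  have "e \<bullet> e = (\<Sum>l<n. (e $ l)\<^sup>2)"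
    by (simp add: scalar_prod_def edim power2_eq_square lessThan_atLeast0)
  also have "\<dots> \<le> (\<Sum>l<n. ((y (Suc l) - y l)\<^sup>2 + (y (Suc (Suc l)) - y (Suc l))\<^sup>2) / 2)"
    by (rule sum_mono) (use el in auto)
  also have "\<dots> = ((\<Sum>l<n. (y (Suc l) - y l)\<^sup>2) + (\<Sum>l<n. (y (Suc (Suc l)) - y (Suc l))\<^sup>2)) / 2"
    by (simp add: sum_divide_distrib[symmetric] sum.distrib)
  also have "(\<Sum>l<n. (y (Suc (Suc l)) - y (Suc l))\<^sup>2) \<le> (\<Sum>l<Suc n. (y (Suc l) - y l)\<^sup>2)"
    by (subst sum.lessThan_Suc_shift) simp
  also have "(\<Sum>l<n. (y (Suc l) - y l)\<^sup>2) \<le> (\<Sum>l<Suc n. (y (Suc l) - y l)\<^sup>2)" by simp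
  finally have "e \<bullet> e \<le> (\<Sum>l<Suc n. (y (Suc l) - y l)\<^sup>2)" by simp
  also have "\<dots> = 2 * (autocorr n v 0 - autocorr n v 1)"
    unfolding sum_diff_squares by (subst sum.lessThan_Suc_shift) (simp add: y_def)
  finally show ?thesis by (simp add: e_def)
qed

lemma coarse_correction_projection:
  fixes A :: "nat \<Rightarrow> real mat"
  assumes k: "k \<ge> 1" and n: "n = 2^k - 1" and m: "m = 2^(k - 1) - 1"
    and A: "A k \<in> carrier_mat n n"
    and coarse: "k > 1 \<Longrightarrow> A (k - 1) = restriction k * A k * prolongation k"
    and pos: "\<And>w. k > 1 \<Longrightarrow> w \<in> carrier_vec m \<Longrightarrow> w \<noteq> 0\<^sub>v m \<Longrightarrow> (A (k - 1) *\<^sub>v w) \<bullet> w > 0"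
  defines "T \<equiv> coarse_correction A k"
  shows "T \<in> carrier_mat n n"
    and "v \<in> carrier_vec n \<Longrightarrow> \<exists>z \<in> carrier_vec m. v = T *\<^sub>v v + prolongation k *\<^sub>v z"
    and "v \<in> carrier_vec n \<Longrightarrow> z \<in> carrier_vec m \<Longrightarrow>
      (A k *\<^sub>v (T *\<^sub>v v)) \<bullet> (prolongation k *\<^sub>v z) = 0"
proof -
  have R: "restriction k \<in> carrier_mat m n" unfolding m n by (rule restriction_carrier)
  have P: "prolongation k \<in> carrier_mat n m" unfolding m n by (rule prolongation_carrier)
  have "T \<in> carrier_mat n n \<and> (\<forall>v \<in> carrier_vec n.
      (\<exists>z \<in> carrier_vec m. v = T *\<^sub>v v + prolongation k *\<^sub>v z) \<and>
      (\<forall>z \<in> carrier_vec m. (A k *\<^sub>v (T *\<^sub>v v)) \<bullet> (prolongation k *\<^sub>v z) = 0))"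
  proof (cases "k = 1")
    case True
    have T: "T = 1\<^sub>m n" using True A by (simp add: T_def coarse_correction_def)
    have Pz: "prolongation k *\<^sub>v z = 0\<^sub>v n" if "z \<in> carrier_vec m" for z
      using P that True by (intro eq_vecI) (auto simp: m scalar_prod_def)
    have "\<exists>z :: real vec. z \<in> carrier_vec m" by (rule exI[of _ "0\<^sub>v m"]) simp
    then show ?thesis using A by (auto simp: T Pz)
  next
    case False
    then have k1: "k > 1" using k by simp
    have RA: "restriction k * A k \<in> carrier_mat m n" using R A by (rule mult_carrier_mat)
    have C: "A (k - 1) \<in> carrier_mat m m" unfolding coarse[OF k1] using RA P by (rule mult_carrier_mat)
    obtain B where inv: "mat_inverse (A (k - 1)) = Some B" and B: "B \<in> carrier_mat m m"
      and CB: "A (k - 1) * B = 1\<^sub>m m"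
      using pos_def_mat_inverse[OF C pos[OF k1]] by blast
    have T: "T = 1\<^sub>m n - prolongation k * B * restriction k * A k"
      using False A inv by (simp add: T_def coarse_correction_def)
    have PB: "prolongation k * B \<in> carrier_mat n m" using P B by (rule mult_carrier_mat)
    have PBR: "prolongation k * B * restriction k \<in> carrier_mat n n"
      using PB R by (rule mult_carrier_mat)
    have Tc: "T \<in> carrier_mat n n"
      unfolding T using mult_carrier_mat[OF PBR A] by (rule minus_carrier_mat)
    have "(\<exists>z \<in> carrier_vec m. v = T *\<^sub>v v + prolongation k *\<^sub>v z) \<and>
      (\<forall>z \<in> carrier_vec m. (A k *\<^sub>v (T *\<^sub>v v)) \<bullet> (prolongation k *\<^sub>v z) = 0)"
      if v: "v \<in> carrier_vec n" for v
    proof -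
      define g where "g = restriction k *\<^sub>v (A k *\<^sub>v v)"
      define w where "w = B *\<^sub>v g"
      have Av: "A k *\<^sub>v v \<in> carrier_vec n" using A v by simp
      have g: "g \<in> carrier_vec m" unfolding g_def using R Av by simp
      have w: "w \<in> carrier_vec m" unfolding w_def using B g by simp
      have Pw: "prolongation k *\<^sub>v w \<in> carrier_vec n" using P w by simp
      have APw: "A k *\<^sub>v (prolongation k *\<^sub>v w) \<in> carrier_vec n" using A Pw by simp
      have Tv: "T *\<^sub>v v = v - prolongation k *\<^sub>v w"
        unfolding T minus_mult_distrib_mat_vec[OF one_carrier_mat mult_carrier_mat[OF PBR A] v]
        using v assoc_mult_mat_vec[OF PBR A v] assoc_mult_mat_vec[OF PB R Av]
          assoc_mult_mat_vec[OF P B g] by (simp add: w_def g_def)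
      then have range: "v = T *\<^sub>v v + prolongation k *\<^sub>v w" using v Pw P by (intro eq_vecI) auto
      have "restriction k *\<^sub>v (A k *\<^sub>v (prolongation k *\<^sub>v w)) = A (k - 1) *\<^sub>v w"
        unfolding coarse[OF k1]
        using assoc_mult_mat_vec[OF RA P w] assoc_mult_mat_vec[OF R A Pw] by simp
      also have "\<dots> = g"
        using assoc_mult_mat_vec[OF C B g] CB g by (simp add: w_def)
      finally have "restriction k *\<^sub>v (A k *\<^sub>v (T *\<^sub>v v)) = 0\<^sub>v m"
        unfolding Tv mult_minus_distrib_mat_vec[OF A v Pw] mult_minus_distrib_mat_vec[OF R Av APw]
        using g by (simp add: g_def[symmetric])
      moreover have "(A k *\<^sub>v (T *\<^sub>v v)) \<bullet> (prolongation k *\<^sub>v z)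
          = 2 * ((restriction k *\<^sub>v (A k *\<^sub>v (T *\<^sub>v v))) \<bullet> z)" if z: "z \<in> carrier_vec m" for z
      proof -
        have RT: "(restriction k)\<^sup>T \<in> carrier_mat n m" using R by simp
        have ATv: "A k *\<^sub>v (T *\<^sub>v v) \<in> carrier_vec n" using A Tc v by simp
        have "prolongation k *\<^sub>v z = 2 \<cdot>\<^sub>v ((restriction k)\<^sup>T *\<^sub>v z)"
          unfolding prolongation_def using R z by (intro eq_vecI) auto
        then show ?thesis using transpose_vec_mult_scalar[OF RT z ATv] ATv RT z by simp
      qed
      ultimately have "(A k *\<^sub>v (T *\<^sub>v v)) \<bullet> (prolongation k *\<^sub>v z) = 0"
        if "z \<in> carrier_vec m" for z
        using that by simp
      with range w show ?thesis by blast
    qed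
    with Tc show ?thesis by blast
  qed
  then show "T \<in> carrier_mat n n"
    and "v \<in> carrier_vec n \<Longrightarrow> \<exists>z \<in> carrier_vec m. v = T *\<^sub>v v + prolongation k *\<^sub>v z"
    and "v \<in> carrier_vec n \<Longrightarrow> z \<in> carrier_vec m \<Longrightarrow>
      (A k *\<^sub>v (T *\<^sub>v v)) \<bullet> (prolongation k *\<^sub>v z) = 0"
    by blast+
qed

lemma energy_opnorm_le:
  assumes M: "M \<in> carrier_mat n n" and n: "n > 0" and C: "C \<ge> 0"
    and pos: "\<And>v. v \<in> carrier_vec n \<Longrightarrow> v \<noteq> 0\<^sub>v n \<Longrightarrow> (M *\<^sub>v v) \<bullet> v > 0"
    and le: "\<And>v. v \<in> carrier_vec n \<Longrightarrow> (M *\<^sub>v (B *\<^sub>v v)) \<bullet> (B *\<^sub>v v) \<le> C * ((M *\<^sub>v v) \<bullet> v)"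
  shows "energy_opnorm M B \<le> sqrt C"
  unfolding energy_opnorm_def
proof (rule cSUP_least)
  have "unit_vec n 0 $ 0 \<noteq> (0\<^sub>v n :: real vec) $ 0" using n by simp
  then have "unit_vec n 0 \<noteq> (0\<^sub>v n :: real vec)" by (rule contrapos_nn) (rule arg_cong)
  then have "(unit_vec n 0 :: real vec) \<in> {v \<in> carrier_vec (dim_row M). v \<noteq> (0\<^sub>v (dim_row M) :: real vec)}"
    using M by simp
  then show "{v \<in> carrier_vec (dim_row M). v \<noteq> (0\<^sub>v (dim_row M) :: real vec)} \<noteq> {}"
    by blast
next
  fix v assume "v \<in> {v \<in> carrier_vec (dim_row M). v \<noteq> (0\<^sub>v (dim_row M) :: real vec)}"
  then have v: "v \<in> carrier_vec n" "v \<noteq> 0\<^sub>v n" using M by auto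
  have "energy_norm M (B *\<^sub>v v) \<le> sqrt C * energy_norm M v"
    unfolding energy_norm_def real_sqrt_mult[symmetric] using le[OF v(1)] by simp
  moreover have "energy_norm M v > 0" unfolding energy_norm_def using pos[OF v] by simp
  ultimately show "energy_norm M (B *\<^sub>v v) / energy_norm M v \<le> sqrt C"
    by (simp add: pos_divide_le_eq)
qed

lemma two_grid_level:
  fixes A :: "nat \<Rightarrow> real mat"
  assumes k: "k \<ge> 1" and pqs: "p > 0" "q \<ge> 0" "s \<ge> 0" "q + s \<le> 2 * p"
    and Ak: "A k = toeplitz (2^k - 1) (band_coeff p q s)"
    and coarse: "k > 1 \<Longrightarrow> A (k - 1) = restriction k * A k * prolongation k"
    and \<eta>: "0 < \<eta>" "\<eta> \<le> 2 * \<omega> * (1 - \<omega>)" "\<eta> \<le> 6"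
  shows "energy_opnorm (A k) (damped_jacobi \<omega> (A k) * coarse_correction A k) \<le> sqrt (1 - \<eta> / 6)"
proof -
  define n m :: nat where "n = 2^k - 1" and "m = 2^(k - 1) - 1"
  define d where "d = 2 * (p + q + s)"
  have d: "d > 0" using pqs by (simp add: d_def)
  note An = Ak[folded n_def]
  have A: "A k \<in> carrier_mat n n" by (simp add: An)
  have P: "prolongation k \<in> carrier_mat n m" unfolding n_def m_def by (rule prolongation_carrier)
  have n: "n > 0" using k one_less_power[of "2::nat" k] by (simp add: n_def)
  have sym: "(A k)\<^sup>T = A k" unfolding An by (rule transpose_toeplitz_band)
  have pos: "(A k *\<^sub>v v) \<bullet> v > 0" if "v \<in> carrier_vec n" "v \<noteq> 0\<^sub>v n" for v
    unfolding An using that pqs by (intro toeplitz_band_pos) auto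
  have nonneg: "(A k *\<^sub>v v) \<bullet> v \<ge> 0" if "v \<in> carrier_vec n" for v
    using pos[OF that] A that by (cases "v = 0\<^sub>v n") (auto simp: less_imp_le)
  have upper: "(A k *\<^sub>v v) \<bullet> v \<le> 2 * d * (v \<bullet> v)" if "v \<in> carrier_vec n" for v
    unfolding An d_def using toeplitz_band_upper[OF that, of p q s] pqs by simp
  have pos': "(A (k - 1) *\<^sub>v w) \<bullet> w > 0"
    if "k > 1" "w \<in> carrier_vec m" "w \<noteq> 0\<^sub>v m" for w
    unfolding coarse[OF that(1)] Ak galerkin_band[OF k] m_def[symmetric]
    using that pqs by (intro toeplitz_band_pos) auto
  note projection = coarse_correction_projection[where A = A, OF k n_def m_def A]
  have T: "coarse_correction A k \<in> carrier_mat n n"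
    by (rule projection(1)) (use coarse pos' in auto)
  have range: "\<exists>z \<in> carrier_vec m. v = coarse_correction A k *\<^sub>v v + prolongation k *\<^sub>v z"
    if "v \<in> carrier_vec n" for v
    by (rule projection(2)) (use coarse pos' that in auto)
  have orth: "(A k *\<^sub>v (coarse_correction A k *\<^sub>v v)) \<bullet> (prolongation k *\<^sub>v z) = 0"
    if "v \<in> carrier_vec n" "z \<in> carrier_vec m" for v z
    by (rule projection(3)) (use coarse pos' that in auto)
  have approx: "\<exists>z \<in> carrier_vec m. d * ((v - prolongation k *\<^sub>v z) \<bullet> (v - prolongation k *\<^sub>v z))
      \<le> 6 * ((A k *\<^sub>v v) \<bullet> v)" if v: "v \<in> carrier_vec n" for v
  proof (rule bexI)
    let ?z = "vec m (\<lambda>i. v $ (2 * i + 1))"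
    have E: "0 \<le> autocorr n v 0 - autocorr n v 1" using abs_autocorr_le[of n v 1] by linarith
    have "d * ((v - prolongation k *\<^sub>v ?z) \<bullet> (v - prolongation k *\<^sub>v ?z))
        \<le> d * (2 * (autocorr n v 0 - autocorr n v 1))"
      using interpolation_estimate[OF k v n_def] d
      unfolding m_def by (intro mult_left_mono) auto
    also have "\<dots> \<le> 6 * (2 * p * (autocorr n v 0 - autocorr n v 1))"
    proof -
      have "2 * d * (autocorr n v 0 - autocorr n v 1) \<le> 12 * p * (autocorr n v 0 - autocorr n v 1)"
        using pqs E by (intro mult_right_mono) (auto simp: d_def)
      then show ?thesis by (simp add: mult_ac)
    qed
    also have "\<dots> \<le> 6 * ((A k *\<^sub>v v) \<bullet> v)"
      unfolding An using toeplitz_band_lower[OF v pqs(2,3), of p] by simp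
    finally show "d * ((v - prolongation k *\<^sub>v ?z) \<bullet> (v - prolongation k *\<^sub>v ?z))
      \<le> 6 * ((A k *\<^sub>v v) \<bullet> v)" .
  qed simp
  have diag: "A k $$ (i, i) = d" if "i < n" for i
    using that by (simp add: An toeplitz_def band_coeff_def d_def)
  have jac_eq: "damped_jacobi \<omega> (A k) = 1\<^sub>m n - (\<omega> / d) \<cdot>\<^sub>m A k"
    using A diag less_imp_neq[OF d, symmetric] by (rule damped_jacobi_eq)
  have jac: "damped_jacobi \<omega> (A k) \<in> carrier_mat n n"
    using A by (simp add: jac_eq minus_carrier_mat)
  show ?thesis
  proof (rule energy_opnorm_le[OF A n _ pos])
    show "0 \<le> 1 - \<eta> / 6" using \<eta> by simp
    fix v :: "real vec" assume v: "v \<in> carrier_vec n"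
    have Tv: "coarse_correction A k *\<^sub>v v \<in> carrier_vec n" using T v by simp
    have jac_apply: "damped_jacobi \<omega> (A k) *\<^sub>v (coarse_correction A k *\<^sub>v v) =
        coarse_correction A k *\<^sub>v v - (\<omega> / d) \<cdot>\<^sub>v (A k *\<^sub>v (coarse_correction A k *\<^sub>v v))"
      using A diag less_imp_neq[OF d, symmetric] Tv by (rule damped_jacobi_apply)
    show "(A k *\<^sub>v (damped_jacobi \<omega> (A k) * coarse_correction A k *\<^sub>v v)) \<bullet>
        (damped_jacobi \<omega> (A k) * coarse_correction A k *\<^sub>v v) \<le> (1 - \<eta> / 6) * ((A k *\<^sub>v v) \<bullet> v)"
      unfolding assoc_mult_mat_vec[OF jac T v] jac_apply
      by (rule two_grid_contraction[OF A sym P T d less_imp_le[OF \<eta>(1)] \<eta>(2) nonneg upper orth range approx v])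
  qed
qed

theorem theorem4p4:
  fixes b \<omega> \<eta> :: real
  assumes "b > 0" and "0 < \<omega>" and "\<omega> < 1" and "0 < \<eta>" and "\<eta> \<le> 2 * \<omega> * (1 - \<omega>)"
  shows "\<exists>h0 > 0. \<forall>(J::nat) (N::nat) (h::real) (\<delta>::real) (A :: nat \<Rightarrow> real mat).
    J \<ge> 1 \<and> N = 2^J - 1 \<and> h = b / (real N + 1) \<and> \<delta> = 3 * h \<and> \<delta> < b \<and> h < h0 \<and>
    A = level_matrix J (stiffness_matrix \<delta> h N) \<longrightarrow>
    (\<forall>k \<in> {1..J}.
      energy_opnorm (A k) (damped_jacobi \<omega> (A k) * coarse_correction A k) \<le> sqrt (1 - \<eta> / 6)
      \<and> sqrt (1 - \<eta> / 6) < 1)"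
proof (intro exI[of _ 1] conjI allI impI ballI; (elim conjE)?)
  fix J N k :: nat and h \<delta> :: real and A :: "nat \<Rightarrow> real mat"
  assume N: "N = 2^J - 1" and h: "h = b / (real N + 1)" and \<delta>: "\<delta> = 3 * h"
    and A: "A = level_matrix J (stiffness_matrix \<delta> h N)" and k: "k \<in> {1..J}"
  define c where "c = band_coeff (1 / (9 * h\<^sup>2)) (1 / (9 * h\<^sup>2)) (4 / (81 * h\<^sup>2))"
  have h0: "h > 0" unfolding h using assms(1) by simp
  have Ak: "A j = galerkin J (toeplitz (2^J - 1) c) (J - j)" for j
    unfolding A \<delta> level_matrix_def stiffness_matrix_R3[OF h0] N c_def ..
  have "J - k < J" using k by auto
  with galerkin_level[of "1 / (9 * h\<^sup>2)" "1 / (9 * h\<^sup>2)" "4 / (81 * h\<^sup>2)" "J - k" J] h0 k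
  obtain p q s where pqs: "p > 0" "q \<ge> 0" "s \<ge> 0" "q + s \<le> 2 * p"
    and eq: "A k = toeplitz (2^k - 1) (band_coeff p q s)"
    by (auto simp: Ak c_def field_simps)
  have "J - (k - 1) = Suc (J - k)" "J - (J - k) = k" using k by auto
  then have coarse: "A (k - 1) = restriction k * A k * prolongation k" by (simp add: Ak)
  have "2 * \<omega> * (1 - \<omega>) \<le> 1"
    using sum_squares_ge_zero[of "2 * \<omega> - 1" 0] by (simp add: algebra_simps)
  then have "\<eta> \<le> 6" using assms by simp
  then show "energy_opnorm (A k) (damped_jacobi \<omega> (A k) * coarse_correction A k) \<le> sqrt (1 - \<eta> / 6)"
    using k assms by (intro two_grid_level[OF _ pqs eq coarse]) auto
  show "sqrt (1 - \<eta> / 6) < 1" using assms by simp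
qed simp

end
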